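(* Let $A$ be a residuated lattice. The following are equivalent: (1) $A$ satisfies $(\star)$: for all $x\in A$, there exist $u\in\mathrm{Rad}(A)$ and $e\in\mathcal{B}(A)$ such that $[x)=[u)\vee[e)$; (2) for any $a\in A$, there exists $e\in\mathcal{B}(A)$ such that $a\odot e$ is nilpotent and $a\vee e\in\mathrm{Rad}(A)$; (3) for any $a\in A$, there exists $e\in\mathcal{B}(A)$ such that $v(a)\subseteq d(e)$ and $d(a)\subseteq v(e)$; (4) for any $a\in A$, there exists $e\in\mathcal{B}(A)$ such that $v(a)\subseteq d(e)$ and, for all $n\in\mathbb{N}^*$, $v(\neg a^n)\subseteq v(e)$.
   Context: A residuated lattice is an algebra $(A,\vee,\wedge,\odot,\rightarrow,0,1)$ such that $(A,\vee,\wedge,0,1)$ is a bounded lattice (with order $\leq$), $(A,\odot,1)$ is a commutative monoid, and $a\leq b\rightarrow c$ iff $a\odot b\leq c$ for all $a,b,c$. Put $\neg a=a\rightarrow 0$; $a^n$ is the $n$-fold $\odot$-power, and $\neg a^n$ means $\neg(a^n)$. $\mathbb{N}^*$ is the set of nonzero natural numbers. An element $a$ is nilpotent iff $a^n=0$ for some $n\in\mathbb{N}^*$. $\mathcal{B}(A)$ is the set of complemented elements of the bounded lattice $(A,\vee,\wedge,0,1)$. A filter of $A$ is a non-empty subset closed under $\odot$ and upward closed; it is proper if it is not $A$. $[x)$ is the filter generated by $x$, i.e. $[x)=\{a\in A\mid x^n\leq a\text{ for some }n\in\mathbb{N}^*\}$; for filters $F,G$, $F\vee G$ is the filter generated by $F\cup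 G$. $\mathrm{Max}(A)$ is the set of maximal (proper) filters, and $\mathrm{Rad}(A)$ is the intersection of all maximal filters. For $a\in A$, $v(a)=\{M\in\mathrm{Max}(A)\mid a\in M\}$ and $d(a)=\{M\in\mathrm{Max}(A)\mid a\notin M\}$. *)

theory Defs
  imports Main
begin

(* The monoid is the multiplicative one, so powers are the library's a ^ n. Its unit 1 is also the
   top of the lattice (integrality); the constant 0 of the algebra is bot. *)
class residuated_lattice = bounded_lattice + comm_monoid_mult +
  fixes residuum :: "'a \<Rightarrow> 'a \<Rightarrow> 'a"
  assumes top_eq_one: "top = 1"
    and residuation: "a \<le> residuum b c \<longleftrightarrow> a * b \<le> c"

definition neg :: "'a::residuated_lattice \<Rightarrow> 'a" where
  "neg a = residuum a bot"

definition nilpotent :: "'a::residuated_lattice \<Rightarrow> bool" where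
  "nilpotent a \<longleftrightarrow> (\<exists>n\<ge>1. a ^ n = bot)"

definition complemented_elements :: "'a::residuated_lattice set" where
  "complemented_elements = {e. \<exists>f. sup e f = top \<and> inf e f = bot}"

definition is_filter :: "'a::residuated_lattice set \<Rightarrow> bool" where
  "is_filter F \<longleftrightarrow> F \<noteq> {} \<and> (\<forall>a\<in>F. \<forall>b\<in>F. a * b \<in> F) \<and> (\<forall>a\<in>F. \<forall>b. a \<le> b \<longrightarrow> b \<in> F)"

definition generated_filter :: "'a::residuated_lattice set \<Rightarrow> 'a set" where
  "generated_filter S = \<Inter>{F. is_filter F \<and> S \<subseteq> F}"

definition principal_filter :: "'a::residuated_lattice \<Rightarrow> 'a set" where
  "principal_filter x = generated_filter {x}"

definition filter_join :: "'a::residuated_lattice set \<Rightarrow> 'a set \<Rightarrow> 'a set" where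
  "filter_join F G = generated_filter (F \<union> G)"

definition maximal_filters :: "'a::residuated_lattice set set" where
  "maximal_filters = {M. is_filter M \<and> M \<noteq> UNIV \<and>
     (\<forall>F. is_filter F \<and> F \<noteq> UNIV \<and> M \<subseteq> F \<longrightarrow> F = M)}"

(* In the one-element algebra there are no maximal filters, and Rad is then the whole algebra. *)
definition Rad :: "'a::residuated_lattice set" where
  "Rad = \<Inter>maximal_filters"

definition vMax :: "'a::residuated_lattice \<Rightarrow> 'a set set" where
  "vMax a = {M \<in> maximal_filters. a \<in> M}"

definition dMax :: "'a::residuated_lattice \<Rightarrow> 'a set set" where
  "dMax a = {M \<in> maximal_filters. a \<notin> M}"

lemma mult_right_mono_rl:
  fixes a b c :: "'a::residuated_lattice"
  assumes "a \<le> b"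
  shows "a * c \<le> b * c"
proof -
  have "b \<le> residuum c (b * c)"
    by (simp add: residuation)
  with assms have "a \<le> residuum c (b * c)"
    by (rule order_trans)
  then show ?thesis
    by (simp add: residuation)
qed

lemma mult_mono_rl:
  fixes a b c e :: "'a::residuated_lattice"
  assumes "a \<le> b" "c \<le> e"
  shows "a * c \<le> b * e"
proof -
  have "a * c \<le> b * c"
    by (rule mult_right_mono_rl[OF assms(1)])
  also have "\<dots> \<le> b * e"
    using mult_right_mono_rl[OF assms(2), of b] by (simp only: mult.commute[of b])
  finally show ?thesis .
qed

lemma principal_filter_eq:
  "principal_filter x = {a. \<exists>n\<ge>1. x ^ n \<le> a}" (is "_ = ?P")
proof
  have "a * b \<in> ?P" if ab: "a \<in> ?P" "b \<in> ?P" for a b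
  proof -
    obtain m n where "m \<ge> 1" "x ^ m \<le> a" "n \<ge> 1" "x ^ n \<le> b"
      using ab by auto
    then have "m + n \<ge> 1" "x ^ (m + n) \<le> a * b"
      by (simp_all add: power_add mult_mono_rl)
    then show ?thesis by blast
  qed
  moreover have x: "x \<in> ?P"
    by (auto intro!: exI[of _ 1])
  moreover have "b \<in> ?P" if "a \<in> ?P" "a \<le> b" for a b
    using that by (auto dest: order_trans)
  ultimately have "is_filter ?P"
    unfolding is_filter_def by blast
  then show "principal_filter x \<subseteq> ?P"
    using x unfolding principal_filter_def generated_filter_def by blast
next
  have "a \<in> F" if F: "is_filter F" "x \<in> F" and "n \<ge> 1" "x ^ n \<le> a" for F a n
  proof -
    have "x ^ n \<in> F"
      using \<open>n \<ge> 1\<close> F by (induction n rule: dec_induct) (auto simp: is_filter_def)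
    then show ?thesis using that unfolding is_filter_def by blast
  qed
  then show "?P \<subseteq> principal_filter x"
    unfolding principal_filter_def generated_filter_def by blast
qed

end

theory Submission
  imports Defs
begin

text \<open>
  All four conditions describe how a complemented element cuts the space of maximal filters into
  two pieces. Three dictionaries make this precise. Maximal filters are prime, so
  \<open>sup a e\<close> lies in the radical iff every maximal filter contains \<open>a\<close> or \<open>e\<close>
  (\<open>sup_in_Rad_iff\<close>). By Zorn's lemma every non-nilpotent element lies in a maximal filter,
  so \<open>a * e\<close> is nilpotent iff no maximal filter contains both \<open>a\<close> and \<open>e\<close>
  (\<open>nilpotent_mult_iff\<close>). Finally a maximal filter omits \<open>a\<close> iff it contains the negation of some
  power of \<open>a\<close> (\<open>dMax_eq_Union_vMax_neg\<close>). Hence, for one and the same pair \<open>a\<close>, \<open>e\<close>, each of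
  conditions (2), (3), (4) says that a maximal filter contains exactly one of \<open>a\<close> and \<open>e\<close>.

  The link with \<open>(\<star>)\<close> passes from \<open>e\<close> to its complement \<open>f\<close>, since a maximal filter contains
  exactly one of these two. If \<open>[x) = [u) \<or> [e)\<close> with \<open>u\<close> in the radical, then
  a maximal filter contains \<open>x\<close> iff it contains \<open>e\<close>, which is (3) for \<open>x\<close> and \<open>f\<close>. Conversely, from
  (2) for \<open>a\<close> and \<open>e\<close> one has \<open>[a) = [sup a e) \<or> [f)\<close>: the product \<open>sup a e * f = a * f\<close> is
  below \<open>a\<close>, and \<open>f\<close> lies above the power of \<open>a\<close> that is annihilated by \<open>e\<close>.
\<close>

section \<open>Arithmetic in residuated lattices\<close>

lemma le_one: "(x::'a::residuated_lattice) \<le> 1"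
  by (metis top_eq_one top_greatest)

lemma mult_le_left: "x * y \<le> (x::'a::residuated_lattice)"
  using mult_mono_rl[OF order_refl le_one, of x y] by simp

lemma mult_le_right: "x * y \<le> (y::'a::residuated_lattice)"
  using mult_le_left[of y x] by (simp add: mult.commute)

lemma mult_bot: "x * bot = (bot::'a::residuated_lattice)"
  using mult_le_right[of x bot] by (simp add: bot_unique)

text \<open>Multiplication by a fixed element is a left adjoint, hence preserves joins.\<close>

lemma mult_sup_distrib:
  "x * sup y z = sup (x * y) (x * (z::'a::residuated_lattice))"
proof (rule antisym)
  have "y \<le> residuum x (sup (x * y) (x * z))" "z \<le> residuum x (sup (x * y) (x * z))"
    by (simp_all add: residuation mult.commute)
  then have "sup y z \<le> residuum x (sup (x * y) (x * z))" by simp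
  then show "x * sup y z \<le> sup (x * y) (x * z)"
    by (simp add: residuation mult.commute)
qed (simp add: mult_mono_rl)

lemma sup_mult_sup_le:
  "sup a c * sup a d \<le> sup a (c * (d::'a::residuated_lattice))"
proof -
  have "sup a c * a \<le> a" by (rule mult_le_right)
  moreover have "sup a c * d = sup (a * d) (c * d)"
    using mult_sup_distrib[of d a c] by (simp add: mult.commute)
  moreover have "a * d \<le> a" by (rule mult_le_left)
  ultimately show ?thesis
    unfolding mult_sup_distrib[of "sup a c" a d] by (auto intro: le_supI1)
qed

text \<open>
  A complement is also a complement for the monoid operation, because \<open>e * f\<close> is below the meet.
\<close>

lemma complemented_obtain:
  assumes "e \<in> complemented_elements"
  obtains f where "f \<in> complemented_elements" "sup e f = 1" "e * f = bot"
proof -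
  obtain f where f: "sup e f = top" "inf e f = bot"
    using assms unfolding complemented_elements_def by blast
  have "e * f \<le> inf e f" by (simp add: mult_le_left mult_le_right)
  with f have "e * f = bot" by (simp add: bot_unique)
  moreover have "f \<in> complemented_elements"
    using f unfolding complemented_elements_def by (auto simp: sup.commute inf.commute)
  ultimately show ?thesis using that f by (simp add: top_eq_one)
qed

section \<open>Filters\<close>

lemma filter_mult: "is_filter F \<Longrightarrow> a \<in> F \<Longrightarrow> b \<in> F \<Longrightarrow> a * b \<in> F"
  and filter_up: "is_filter F \<Longrightarrow> a \<in> F \<Longrightarrow> a \<le> b \<Longrightarrow> b \<in> F"
  unfolding is_filter_def by blast+

lemma filter_one: "is_filter F \<Longrightarrow> 1 \<in> F"
  unfolding is_filter_def using le_one by blast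

lemma filter_power: "is_filter F \<Longrightarrow> a \<in> F \<Longrightarrow> a ^ n \<in> F"
  by (induction n) (auto intro: filter_mult filter_one)

lemma filter_mult_iff: "is_filter F \<Longrightarrow> a * b \<in> F \<longleftrightarrow> a \<in> F \<and> b \<in> F"
  by (meson filter_mult filter_up mult_le_left mult_le_right)

lemma filter_UNIV_iff: "is_filter F \<Longrightarrow> F = UNIV \<longleftrightarrow> bot \<in> F"
  using filter_up[of F bot] by auto

lemma principal_filter_subset_iff:
  "is_filter F \<Longrightarrow> principal_filter x \<subseteq> F \<longleftrightarrow> x \<in> F"
  unfolding principal_filter_def generated_filter_def by blast

lemma is_filter_generated: "is_filter (generated_filter S)"
proof -
  have "1 \<in> generated_filter S"
    unfolding generated_filter_def using filter_one by blast
  then show ?thesis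
    unfolding is_filter_def generated_filter_def by blast
qed

lemma is_filter_principal: "is_filter (principal_filter x)"
  unfolding principal_filter_def by (rule is_filter_generated)

lemma filter_join_principal_subset_iff:
  assumes "is_filter F"
  shows "filter_join (principal_filter x) (principal_filter y) \<subseteq> F \<longleftrightarrow> x \<in> F \<and> y \<in> F"
proof -
  have "filter_join (principal_filter x) (principal_filter y) \<subseteq> F \<longleftrightarrow>
      principal_filter x \<union> principal_filter y \<subseteq> F"
    unfolding filter_join_def generated_filter_def using assms by blast
  then show ?thesis
    by (simp add: principal_filter_subset_iff[OF assms])
qed

section \<open>Maximal filters\<close>

lemma maximal_is_filter: "M \<in> maximal_filters \<Longrightarrow> is_filter M"
  unfolding maximal_filters_def by blast

lemma maximal_bot: "M \<in> maximal_filters \<Longrightarrow> bot \<notin> M"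
  unfolding maximal_filters_def using filter_UNIV_iff by blast

lemma maximal_extension:
  "M \<in> maximal_filters \<Longrightarrow> is_filter F \<Longrightarrow> M \<subseteq> F \<Longrightarrow> F = M \<or> bot \<in> F"
  unfolding maximal_filters_def using filter_UNIV_iff by blast

text \<open>
  Zorn's lemma applies to the filters that contain \<open>x\<close> and omit \<open>bot\<close>; this class is not empty, as
  \<open>[x)\<close> omits \<open>bot\<close> when no power of \<open>x\<close> vanishes.
\<close>

lemma non_nilpotent_in_maximal:
  assumes "\<not> nilpotent x"
  shows "\<exists>M\<in>maximal_filters. x \<in> M"
proof -
  define \<A> where "\<A> = {F. is_filter F \<and> x \<in> F \<and> bot \<notin> F}"
  have "bot \<notin> principal_filter x"
    using assms unfolding principal_filter_eq nilpotent_def by (auto simp: bot_unique)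
  moreover have "x \<in> principal_filter x"
    using principal_filter_subset_iff[OF is_filter_principal] by blast
  ultimately have "principal_filter x \<in> \<A>"
    unfolding \<A>_def using is_filter_principal by blast
  then have ne: "\<A> \<noteq> {}" by blast
  have "\<exists>M\<in>\<A>. \<forall>X\<in>\<A>. M \<subseteq> X \<longrightarrow> X = M"
  proof (rule subset_Zorn_nonempty[OF ne])
    fix C assume C: "C \<noteq> {}" "subset.chain \<A> C"
    then have lin: "F \<subseteq> G \<or> G \<subseteq> F" if "F \<in> C" "G \<in> C" for F G
      using that by (auto simp: subset_chain_def)
    have CA: "C \<subseteq> \<A>" using C by (simp add: subset_chain_def)
    have "a * b \<in> \<Union>C" if ab: "a \<in> \<Union>C" "b \<in> \<Union>C" for a b
    proof -
      obtain F G where FG: "F \<in> C" "a \<in> F" "G \<in> C" "b \<in> G" using ab by blast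
      obtain H where "H \<in> C" "a \<in> H" "b \<in> H"
        using lin[OF FG(1,3)] FG by blast
      then show ?thesis using CA filter_mult unfolding \<A>_def by blast
    qed
    moreover have "b \<in> \<Union>C" if "a \<in> \<Union>C" "a \<le> b" for a b
      using that CA filter_up unfolding \<A>_def by blast
    moreover have "x \<in> \<Union>C" "bot \<notin> \<Union>C"
      using C CA unfolding \<A>_def by blast+
    ultimately show "\<Union>C \<in> \<A>"
      unfolding \<A>_def is_filter_def by blast
  qed
  then obtain M where M: "M \<in> \<A>" and max: "\<And>X. X \<in> \<A> \<Longrightarrow> M \<subseteq> X \<Longrightarrow> X = M"
    by blast
  have "M \<in> maximal_filters"
    unfolding maximal_filters_def
  proof (intro CollectI conjI allI impI)
    show "is_filter M" "M \<noteq> UNIV" using M unfolding \<A>_def by auto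
    show "F = M" if "is_filter F \<and> F \<noteq> UNIV \<and> M \<subseteq> F" for F
    proof (rule max)
      show "F \<in> \<A>"
        using that M filter_UNIV_iff[of F] unfolding \<A>_def by auto
    qed (use that in blast)
  qed
  then show ?thesis using M unfolding \<A>_def by blast
qed

text \<open>
  Primeness: the elements \<open>c\<close> with \<open>sup a c\<close> in \<open>M\<close> form a filter containing \<open>M\<close> and \<open>b\<close>. By
  maximality it is \<open>M\<close> itself, which puts \<open>b\<close> in \<open>M\<close>, or it contains \<open>bot\<close>, which means \<open>a \<in> M\<close>.
\<close>

lemma maximal_sup_iff:
  assumes M: "M \<in> maximal_filters"
  shows "sup a b \<in> M \<longleftrightarrow> a \<in> M \<or> b \<in> M"
proof
  note F = maximal_is_filter[OF M]
  let ?G = "{c. sup a c \<in> M}"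
  assume ab: "sup a b \<in> M"
  have "M \<subseteq> ?G" using filter_up[OF F] by auto
  moreover have "is_filter ?G"
    unfolding is_filter_def
  proof (intro conjI ballI allI impI)
    show "?G \<noteq> {}" using ab by blast
    show "c * d \<in> ?G" if "c \<in> ?G" "d \<in> ?G" for c d
      using that filter_mult[OF F] filter_up[OF F _ sup_mult_sup_le] by blast
    show "d \<in> ?G" if "c \<in> ?G" "c \<le> d" for c d
      using that filter_up[OF F, of "sup a c" "sup a d"] by (auto intro: le_supI2)
  qed
  ultimately have "?G = M \<or> sup a bot \<in> M"
    using maximal_extension[OF M] by blast
  then show "a \<in> M \<or> b \<in> M" using ab by auto
next
  show "a \<in> M \<or> b \<in> M \<Longrightarrow> sup a b \<in> M"
    using filter_up[OF maximal_is_filter[OF M]] by auto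
qed

text \<open>
  If \<open>M\<close> omits \<open>a\<close>, the filter generated by \<open>M\<close> and \<open>a\<close> contains \<open>bot\<close>; thus \<open>m * a ^ n\<close>
  vanishes for some \<open>m \<in> M\<close>, and by residuation \<open>m\<close> lies below \<open>neg (a ^ n)\<close>.
\<close>

lemma maximal_omits_iff:
  assumes M: "M \<in> maximal_filters"
  shows "a \<notin> M \<longleftrightarrow> (\<exists>n\<ge>1. neg (a ^ n) \<in> M)"
proof
  note F = maximal_is_filter[OF M]
  let ?G = "{c. \<exists>n\<ge>1. \<exists>m\<in>M. m * a ^ n \<le> c}"
  assume a: "a \<notin> M"
  have sub: "M \<subseteq> ?G" using mult_le_left by (auto intro: exI[of _ 1])
  have aG: "a \<in> ?G" using filter_one[OF F] by (auto intro!: exI[of _ 1] bexI[of _ 1])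
  have "is_filter ?G"
    unfolding is_filter_def
  proof (intro conjI ballI allI impI)
    show "?G \<noteq> {}" using aG by blast
    show "d \<in> ?G" if "c \<in> ?G" "c \<le> d" for c d
      using that by (auto dest: order_trans)
    fix c d assume "c \<in> ?G" "d \<in> ?G"
    then obtain m k n l where h: "m \<in> M" "k \<in> M" "n \<ge> 1" "l \<ge> 1"
      "m * a ^ n \<le> c" "k * a ^ l \<le> d" by blast
    have "(m * k) * a ^ (n + l) = (m * a ^ n) * (k * a ^ l)"
      by (simp add: power_add ac_simps)
    also have "\<dots> \<le> c * d" using h by (intro mult_mono_rl)
    finally have "(m * k) * a ^ (n + l) \<le> c * d" .
    moreover have "m * k \<in> M" "n + l \<ge> 1" using h filter_mult[OF F] by auto
    ultimately show "c * d \<in> ?G" by blast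
  qed
  with sub aG a have "bot \<in> ?G" using maximal_extension[OF M] by blast
  then obtain n m where "n \<ge> 1" "m \<in> M" "m \<le> neg (a ^ n)"
    unfolding neg_def by (auto simp: residuation)
  then show "\<exists>n\<ge>1. neg (a ^ n) \<in> M" using filter_up[OF F] by blast
next
  note F = maximal_is_filter[OF M]
  assume "\<exists>n\<ge>1. neg (a ^ n) \<in> M"
  then obtain n where n: "neg (a ^ n) \<in> M" by blast
  have "neg (a ^ n) * a ^ n \<le> bot"
    using residuation[of "neg (a ^ n)"] unfolding neg_def by blast
  then have "a ^ n \<notin> M"
    using n F maximal_bot[OF M] filter_mult filter_up by blast
  then show "a \<notin> M" using filter_power[OF F] by blast
qed

section \<open>The conditions as statements about maximal filters\<close>

lemma nilpotent_iff_vMax_empty: "nilpotent x \<longleftrightarrow> vMax x = {}"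
proof
  assume "nilpotent x"
  then obtain n where n: "x ^ n = bot" unfolding nilpotent_def by blast
  show "vMax x = {}"
    using filter_power[OF maximal_is_filter, of _ x n] maximal_bot
    unfolding vMax_def n by blast
qed (use non_nilpotent_in_maximal in \<open>auto simp: vMax_def\<close>)

lemma nilpotent_mult_iff: "nilpotent (a * e) \<longleftrightarrow> vMax a \<subseteq> dMax e"
  unfolding nilpotent_iff_vMax_empty vMax_def dMax_def
  using filter_mult_iff[OF maximal_is_filter, of _ a e] by blast

lemma sup_in_Rad_iff: "sup a e \<in> Rad \<longleftrightarrow> dMax a \<subseteq> vMax e"
  unfolding Rad_def vMax_def dMax_def using maximal_sup_iff by blast

lemma dMax_eq_Union_vMax_neg: "dMax a = (\<Union>n\<in>{1..}. vMax (neg (a ^ n)))"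
  unfolding dMax_def vMax_def using maximal_omits_iff[of _ a] by auto

text \<open>
  A radical generator is invisible to maximal filters, so \<open>x\<close> and \<open>e\<close> lie in the same ones, and the
  complement \<open>f\<close> of \<open>e\<close> lies in exactly the others.
\<close>

lemma star_imp_separation:
  assumes u: "u \<in> Rad" and e: "e \<in> complemented_elements"
    and x: "principal_filter x = filter_join (principal_filter u) (principal_filter e)"
  shows "\<exists>f\<in>complemented_elements. vMax x \<subseteq> dMax f \<and> dMax x \<subseteq> vMax f"
proof -
  obtain f where f: "f \<in> complemented_elements" "sup e f = 1" "e * f = bot"
    using complemented_obtain[OF e] by blast
  have "x \<in> M \<longleftrightarrow> f \<notin> M" if M: "M \<in> maximal_filters" for M
  proof -
    note F = maximal_is_filter[OF M]
    have "u \<in> M" using u M unfolding Rad_def by blast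
    then have "x \<in> M \<longleftrightarrow> e \<in> M"
      using principal_filter_subset_iff[OF F, of x] filter_join_principal_subset_iff[OF F, of u e]
      unfolding x by blast
    also have "\<dots> \<longleftrightarrow> f \<notin> M"
      using filter_mult[OF F, of e f] maximal_bot[OF M] maximal_sup_iff[OF M, of e f]
        filter_one[OF F] f by auto
    finally show ?thesis .
  qed
  then show ?thesis using f(1) unfolding vMax_def dMax_def by blast
qed

text \<open>
  Multiplication by \<open>f\<close> erases \<open>e\<close> from \<open>sup a e\<close> and leaves \<open>f * a \<le> a\<close>. In the other direction,
  \<open>e\<close> annihilates some power \<open>a ^ n\<close>, so splitting \<open>a ^ n\<close> along \<open>sup e f = 1\<close> leaves
  \<open>a ^ n = a ^ n * f \<le> f\<close>.
\<close>

lemma principal_filter_decomposition: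
  assumes ef: "sup e f = 1" "e * f = bot" and nil: "nilpotent (a * e)"
  shows "principal_filter a =
    filter_join (principal_filter (sup a e)) (principal_filter f)" (is "_ = ?J")
proof
  have J: "is_filter ?J" unfolding filter_join_def by (rule is_filter_generated)
  have "sup a e \<in> ?J" "f \<in> ?J"
    using filter_join_principal_subset_iff[OF J] by blast+
  then have "f * sup a e \<in> ?J" by (intro filter_mult[OF J])
  moreover have "f * sup a e = f * a"
    unfolding mult_sup_distrib using ef by (simp add: mult.commute)
  ultimately have "a \<in> ?J" using filter_up[OF J _ mult_le_right] by metis
  then show "principal_filter a \<subseteq> ?J" by (simp add: principal_filter_subset_iff[OF J])
next
  have P: "is_filter (principal_filter a)" by (rule is_filter_principal)
  then have a: "a \<in> principal_filter a" using principal_filter_subset_iff by blast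
  obtain n where n: "(a * e) ^ n = bot" using nil unfolding nilpotent_def by blast
  \<comment> \<open>Expanding \<open>sup e f = 1\<close> shows that \<open>e\<close> is idempotent, so \<open>e\<close> can stand in for
    \<open>e * e ^ n\<close> and annihilates a power of \<open>a\<close>.\<close>
  have "e * sup e f = e * e" unfolding mult_sup_distrib using ef by simp
  then have "e * e = e" using ef by simp
  then have "e * e ^ n = e" by (induction n) (simp_all add: mult.assoc[symmetric])
  then have "a ^ n * e = e * (a * e) ^ n"
    by (metis power_mult_distrib mult.left_commute)
  then have "a ^ n * e = bot" using n by (simp add: mult_bot)
  then have "a ^ n = a ^ n * f"
    using mult_sup_distrib[of "a ^ n" e f] ef by simp
  then have "a ^ n \<le> f" by (metis mult_le_right)
  then have "f \<in> principal_filter a" using filter_up[OF P] filter_power[OF P a] by blast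
  moreover have "sup a e \<in> principal_filter a" using filter_up[OF P a] by simp
  ultimately show "?J \<subseteq> principal_filter a"
    by (simp add: filter_join_principal_subset_iff[OF P])
qed

theorem theorem6p22:
  shows "let
      P1 = (\<forall>x::'a::residuated_lattice. \<exists>u\<in>Rad. \<exists>e\<in>complemented_elements.
              principal_filter x = filter_join (principal_filter u) (principal_filter e));
      P2 = (\<forall>a::'a. \<exists>e\<in>complemented_elements. nilpotent (a * e) \<and> sup a e \<in> Rad);
      P3 = (\<forall>a::'a. \<exists>e\<in>complemented_elements. vMax a \<subseteq> dMax e \<and> dMax a \<subseteq> vMax e);
      P4 = (\<forall>a::'a. \<exists>e\<in>complemented_elements. vMax a \<subseteq> dMax e \<and>
              (\<forall>n\<ge>1. vMax (neg (a ^ n)) \<subseteq> vMax e))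
    in (P1 \<longleftrightarrow> P2) \<and> (P2 \<longleftrightarrow> P3) \<and> (P3 \<longleftrightarrow> P4)"
  unfolding Let_def
proof (intro conjI)
  let ?P1 = "\<forall>x::'a. \<exists>u\<in>Rad. \<exists>e\<in>complemented_elements.
    principal_filter x = filter_join (principal_filter u) (principal_filter e)"
  let ?P2 = "\<forall>a::'a. \<exists>e\<in>complemented_elements. nilpotent (a * e) \<and> sup a e \<in> Rad"
  let ?P3 = "\<forall>a::'a. \<exists>e\<in>complemented_elements. vMax a \<subseteq> dMax e \<and> dMax a \<subseteq> vMax e"
  let ?P4 = "\<forall>a::'a. \<exists>e\<in>complemented_elements. vMax a \<subseteq> dMax e \<and>
    (\<forall>n\<ge>1. vMax (neg (a ^ n)) \<subseteq> vMax e)"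
  show P23: "?P2 \<longleftrightarrow> ?P3" by (simp only: nilpotent_mult_iff sup_in_Rad_iff)
  have "dMax a \<subseteq> vMax e \<longleftrightarrow> (\<forall>n\<ge>1. vMax (neg (a ^ n)) \<subseteq> vMax e)" for a e :: 'a
    unfolding dMax_eq_Union_vMax_neg by auto
  then show "?P3 \<longleftrightarrow> ?P4" by simp
  show "?P1 \<longleftrightarrow> ?P2"
  proof
    assume ?P1
    then have ?P3 using star_imp_separation by meson
    then show ?P2 using P23 by blast
  next
    assume P2: ?P2
    show ?P1
    proof
      fix x :: 'a
      obtain e where e: "e \<in> complemented_elements" "nilpotent (x * e)" "sup x e \<in> Rad"
        using P2 by blast
      obtain f where f: "f \<in> complemented_elements" "sup e f = 1" "e * f = bot"
        using complemented_obtain[OF e(1)] by blast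
      show "\<exists>u\<in>Rad. \<exists>e\<in>complemented_elements.
          principal_filter x = filter_join (principal_filter u) (principal_filter e)"
        using principal_filter_decomposition[OF f(2,3) e(2)] e(3) f(1) by blast
    qed
  qed
qed

end
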